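(* Let $J(x)=\tfrac12(x+x^{-1})-1$ for $x>0$. Let $S$ be a set with scale map $\iota_S:S\to\mathbb{R}_{>0}$, and let $O=\{o_1,\dots,o_N\}$ be a finite set with scale map $\iota_O:O\to\mathbb{R}_{>0}$ such that the values $y_i:=\iota_O(o_i)$ satisfy $0<y_1<\cdots<y_N$. Let $c_{\mathcal{R}}(s,o)=J(\iota_S(s)/\iota_O(o))$, let $m_i:=\sqrt{y_iy_{i+1}}$ for $i=1,\dots,N-1$, and $m_0:=0$, $m_N:=+\infty$. If $k\in\{1,\dots,N\}$ and $m_{k-1}<x<m_k$, then there exists $\delta>0$ such that every $x'$ with $|x'-x|<\delta$ satisfies $m_{k-1}<x'<m_k$, and hence has the same unique meaning $o_k$ (that is, $o_k$ is the unique minimizer over $i$ of $J(x'/y_i)$, so $\mathrm{Mean}_{\mathcal{R}}(s')=\{o_k\}$ for every $s'\in S$ with $\iota_S(s')=x'$).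
   Context: For a reference cost $c_{\mathcal{R}}:S\times O\to\mathbb{R}_{\ge0}$ and $s\in S$, the meaning set is $\mathrm{Mean}_{\mathcal{R}}(s):=\{o\in O:\ c_{\mathcal{R}}(s,o)\le c_{\mathcal{R}}(s,o')\ \text{for all } o'\in O\}$. *)

theory Defs
  imports Complex_Main "HOL-Library.Extended_Real"
begin

text \<open>Meant for positive arguments only.\<close>
definition J :: "real \<Rightarrow> real" where
  "J x = (1 / 2) * (x + inverse x) - 1"

definition ref_cost :: "('s \<Rightarrow> real) \<Rightarrow> ('o \<Rightarrow> real) \<Rightarrow> 's \<Rightarrow> 'o \<Rightarrow> real" where
  "ref_cost \<iota>S \<iota>O s b = J (\<iota>S s / \<iota>O b)"

text \<open>The set of objects is a carrier \<open>Obj\<close>, so minimality only ranges over \<open>Obj\<close>.\<close>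
definition Mean :: "('s \<Rightarrow> 'o \<Rightarrow> real) \<Rightarrow> 'o set \<Rightarrow> 's \<Rightarrow> 'o set" where
  "Mean c Obj s = {b \<in> Obj. \<forall>b'\<in>Obj. c s b \<le> c s b'}"

text \<open>
  The cell boundaries \<open>m 0 = 0\<close>, \<open>m i = sqrt (y i * y (i + 1))\<close> for \<open>0 < i < N\<close>, and
  \<open>m N = \<infinity>\<close>; extended reals because of the last one. Only used for \<open>N \<ge> 1\<close> and \<open>i \<le> N\<close>.
\<close>
definition cell_bound :: "(nat \<Rightarrow> real) \<Rightarrow> nat \<Rightarrow> nat \<Rightarrow> ereal" where
  "cell_bound y N i =
     (if i = 0 then 0 else if i = N then \<infinity> else ereal (sqrt (y i * y (i + 1))))"

end

theory Submission
  imports Defs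
begin

text \<open>
  Since \<open>2 (J (x / b) - J (x / a)) = (b - a) (a b - x\<^sup>2) / (a b x)\<close>, two objects \<open>a < b\<close> compete at
  the threshold \<open>sqrt (a b)\<close>. Monotonicity of \<open>y\<close> makes the two thresholds adjacent to \<open>k\<close>
  the binding ones, and a cell is an open set.
\<close>

text \<open>The sign condition is one product so that both orders are covered: it says
  \<open>x\<^sup>2 < a * b\<close> when \<open>a < b\<close>, and \<open>x\<^sup>2 > a * b\<close>
  when \<open>b < a\<close>.\<close>

lemma J_divide_less:
  assumes "0 < a" "0 < b" "0 < x" "0 < (b - a) * (a * b - x\<^sup>2)"
  shows "J (x / a) < J (x / b)"
proof -
  have "J (x / b) - J (x / a) = (b - a) * (a * b - x\<^sup>2) / (2 * (a * b * x))"
    using assms(1-3) by (simp add: J_def field_simps power2_eq_square)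
  moreover have "0 < (b - a) * (a * b - x\<^sup>2) / (2 * (a * b * x))"
    using assms by simp
  ultimately show ?thesis by simp
qed

text \<open>A competitor \<open>j < k\<close> is ruled out by the lower boundary of the cell and a
  competitor \<open>j > k\<close> by the upper one, since the neighbour of \<open>k\<close> on that
  side gives the most restrictive threshold.\<close>

lemma cell_J_less:
  fixes y :: "nat \<Rightarrow> real"
  assumes pos: "\<And>i. i \<in> {1..N} \<Longrightarrow> 0 < y i"
    and mono: "strict_mono_on {1..N} y"
    and k: "k \<in> {1..N}" and j: "j \<in> {1..N}" "j \<noteq> k"
    and lo: "cell_bound y N (k - 1) < ereal x" and hi: "ereal x < cell_bound y N k"
  shows "J (x / y k) < J (x / y j)"
proof -
  have le: "y a \<le> y b" if "a \<in> {1..N}" "b \<in> {1..N}" "a \<le> b" for a b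
    using strict_mono_on_leD[OF mono that] .
  \<comment> \<open>Positivity of \<open>x\<close> comes from the cell itself. It also allows
    writing \<open>x\<close> as \<open>sqrt (x\<^sup>2)\<close>, so that comparing roots amounts to
    comparing radicands.\<close>
  have "0 \<le> cell_bound y N (k - 1)"
    using k by (auto simp: cell_bound_def intro!: mult_nonneg_nonneg less_imp_le[OF pos])
  with lo have x: "0 < x"
    by (metis ereal_less(2) le_less_trans)
  have yk: "0 < y k" and yj: "0 < y j"
    using pos k j by auto
  show ?thesis
  proof (rule J_divide_less[OF yk yj x])
    consider "j < k" | "k < j" using j by linarith
    then show "0 < (y j - y k) * (y k * y j - x\<^sup>2)"
    proof cases
      case 1
      \<comment> \<open>Here \<open>1 \<le> j \<le> k - 1 < N\<close>, so the lower boundary is a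
        genuine square root and not the value 0.\<close>
      then have "sqrt (y (k - 1) * y k) < x"
        using lo k j by (auto simp: cell_bound_def split: if_splits)
      then have "y (k - 1) * y k < x\<^sup>2"
        using x by (metis abs_of_pos real_sqrt_abs real_sqrt_less_iff)
      moreover have "y j * y k \<le> y (k - 1) * y k"
        using 1 k j yk by (intro mult_right_mono le) auto
      moreover have "y j < y k"
        using strict_mono_onD[OF mono j(1) k 1] .
      ultimately show ?thesis
        by (intro mult_neg_neg) (auto simp: mult.commute)
    next
      case 2
      \<comment> \<open>Here \<open>k < j \<le> N\<close>, so the upper boundary is finite.\<close>
      then have "x < sqrt (y k * y (k + 1))"
        using hi k j by (auto simp: cell_bound_def)
      then have "x\<^sup>2 < y k * y (k + 1)"
        using x by (metis abs_of_pos real_sqrt_abs real_sqrt_less_iff)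
      moreover have "y k * y (k + 1) \<le> y k * y j"
        using 2 k j yk by (intro mult_left_mono le) auto
      moreover have "y k < y j"
        using strict_mono_onD[OF mono k j(1) 2] .
      ultimately show ?thesis
        by (intro mult_pos_pos) auto
    qed
  qed
qed

theorem corollary7p4:
  fixes S :: "'s set" and \<iota>S :: "'s \<Rightarrow> real"
    and Obj :: "'o set" and \<iota>O :: "'o \<Rightarrow> real"
    and ob :: "nat \<Rightarrow> 'o" and y :: "nat \<Rightarrow> real"
    and N k :: nat and x :: real
  assumes "\<And>s. s \<in> S \<Longrightarrow> 0 < \<iota>S s"
    and "Obj = ob ` {1..N}"
    and "\<And>b. b \<in> Obj \<Longrightarrow> 0 < \<iota>O b"
    and "\<And>i. i \<in> {1..N} \<Longrightarrow> y i = \<iota>O (ob i)"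
    and "strict_mono_on {1..N} y"
    and "k \<in> {1..N}"
    and "cell_bound y N (k - 1) < ereal x" and "ereal x < cell_bound y N k"
  shows "\<exists>\<delta>>0. \<forall>x'. \<bar>x' - x\<bar> < \<delta> \<longrightarrow>
           cell_bound y N (k - 1) < ereal x' \<and> ereal x' < cell_bound y N k \<and>
           (\<forall>i. is_arg_min (\<lambda>j. J (x' / y j)) (\<lambda>j. j \<in> {1..N}) i \<longleftrightarrow> i = k) \<and>
           (\<forall>s'\<in>S. \<iota>S s' = x' \<longrightarrow> Mean (ref_cost \<iota>S \<iota>O) Obj s' = {ob k})"
proof -
  have pos: "0 < y i" if "i \<in> {1..N}" for i
    using assms(2-4) that by auto
  \<comment> \<open>Pulling the open interval back along the continuous map \<open>ereal\<close>
    treats finite and infinite upper ends alike; any ball around \<open>x\<close> inside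
    \<open>C\<close> supplies \<delta>.\<close>
  define C where "C = ereal -` {cell_bound y N (k - 1)<..<cell_bound y N k}"
  have "open C"
    unfolding C_def by (intro open_vimage continuous_on_ereal continuous_on_id) auto
  moreover have "x \<in> C"
    using assms(7,8) by (simp add: C_def)
  ultimately obtain \<delta> where \<delta>: "0 < \<delta>" "\<And>x'. \<bar>x' - x\<bar> < \<delta> \<Longrightarrow> x' \<in> C"
    unfolding open_dist dist_real_def by blast
  show ?thesis
  proof (intro exI[of _ \<delta>] conjI allI impI ballI)
    fix x' assume "\<bar>x' - x\<bar> < \<delta>"
    then have "x' \<in> C" by (rule \<delta>)
    then show lo: "cell_bound y N (k - 1) < ereal x'" and hi: "ereal x' < cell_bound y N k"
      by (simp_all add: C_def)
    have less: "J (x' / y k) < J (x' / y j)" if "j \<in> {1..N}" "j \<noteq> k" for j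
      using cell_J_less[OF pos assms(5,6) that lo hi] .
    show "is_arg_min (\<lambda>j. J (x' / y j)) (\<lambda>j. j \<in> {1..N}) i \<longleftrightarrow> i = k" for i
      using less assms(6) unfolding is_arg_min_def by (metis less_asym less_irrefl)
    show "Mean (ref_cost \<iota>S \<iota>O) Obj s' = {ob k}" if "s' \<in> S" "\<iota>S s' = x'" for s'
    proof -
      have cost: "ref_cost \<iota>S \<iota>O s' (ob j) = J (x' / y j)" if "j \<in> {1..N}" for j
        using that assms(4) \<open>\<iota>S s' = x'\<close> by (simp add: ref_cost_def)
      have le: "J (x' / y k) \<le> J (x' / y j)" if "j \<in> {1..N}" for j
        using less[OF that] by (cases "j = k") auto
      show ?thesis
      proof (intro equalityI subsetI)
        fix b assume b: "b \<in> Mean (ref_cost \<iota>S \<iota>O) Obj s'"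
        then obtain j where j: "j \<in> {1..N}" "b = ob j"
          using assms(2) by (auto simp: Mean_def)
        have "ref_cost \<iota>S \<iota>O s' b \<le> ref_cost \<iota>S \<iota>O s' (ob k)"
          using b assms(2,6) by (auto simp: Mean_def)
        \<comment> \<open>Strictness for every index other than \<open>k\<close> now forces
          \<open>j = k\<close>, hence \<open>b = ob k\<close>.\<close>
        then have "\<not> J (x' / y k) < J (x' / y j)"
          using cost j assms(6) by simp
        with less j show "b \<in> {ob k}" by auto
      next
        fix b assume "b \<in> {ob k}"
        then show "b \<in> Mean (ref_cost \<iota>S \<iota>O) Obj s'"
          using le cost assms(2,6) by (auto simp: Mean_def)
      qed
    qed
  qed (rule \<delta>(1))
qed

end
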